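(* Let $N$ be a positive number. If $f(x)$ is a positive increasing log-convex function for $x\geq N$ and $f(N)\leq 1$, then $\sqrt[x]{f(x)}=f(x)^{1/x}$ is strictly increasing on $(N,\infty)$.
   Context: A positive function $f$ is log-convex if $\log f$ is convex. *)

theory Defs
  imports "HOL-Analysis.Analysis"
begin

(* Positivity is part of the definition because ln takes junk values outside the
   positive reals; convexity of S is already part of convex_on. *)
definition log_convex_on :: "'a::real_vector set \<Rightarrow> ('a \<Rightarrow> real) \<Rightarrow> bool" where
  "log_convex_on S f \<longleftrightarrow> (\<forall>x\<in>S. 0 < f x) \<and> convex_on S (\<lambda>x. ln (f x))"

end

theory Submission
  imports Defs
begin

text \<open>
  Put \<open>g = ln \<circ> f\<close>, so that the claim is \<open>g x / x < g y / y\<close> for \<open>N < x < y\<close>. If \<open>g y \<le> 0\<close>, monotonicity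
  of \<open>g\<close> suffices: \<open>g x / x < g y / x \<le> g y / y\<close>. If \<open>g y > 0\<close>, then \<open>g N \<le> 0\<close> and convexity bound \<open>g x\<close> by
  \<open>(x - N) / (y - N) * g y\<close>, and the slope factor is smaller than \<open>x / y\<close> because \<open>N > 0\<close>.
\<close>

lemma convex_increasing_divide_strict_mono:
  fixes g :: "real \<Rightarrow> real"
  assumes N: "0 < N" and g: "convex_on {N..} g" and mono: "strict_mono_on {N..} g" and gN: "g N \<le> 0"
  shows "strict_mono_on {N<..} (\<lambda>x. g x / x)"
proof (rule strict_mono_onI)
  fix x y assume "x \<in> {N<..}" "y \<in> {N<..}" and xy: "x < y"
  then have Nx: "N < x" and Ny: "N < y" by auto
  show "g x / x < g y / y"
  proof (cases "g y \<le> 0")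
    case True
    have "g x < g y" using mono Nx xy by (auto simp: strict_mono_on_def)
    then have "g x / x < g y / x" using N Nx by (simp add: divide_strict_right_mono)
    also have "\<dots> \<le> g y / y"
      using divide_left_mono_neg[of x y "g y"] True N Nx Ny xy by simp
    finally show ?thesis .
  next
    case False
    \<comment> \<open>The weight that writes \<open>x\<close> as a convex combination of
      \<open>N\<close> and \<open>y\<close>.\<close>
    define t where "t = (x - N) / (y - N)"
    have t: "0 \<le> t" "t \<le> 1" using Nx xy by (auto simp: t_def)
    have "x = (1 - t) * N + t * y"
    proof -
      have "t * (y - N) = x - N" using Ny by (simp add: t_def)
      then show ?thesis by (simp add: algebra_simps)
    qed
    then have "g x \<le> (1 - t) * g N + t * g y"
      using convex_onD[OF g t, of N y] Ny by simp
    also have "\<dots> \<le> t * g y"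
      using t gN by (simp add: mult_nonneg_nonpos)
    also have "\<dots> < x / y * g y"
    proof (rule mult_strict_right_mono)
      \<comment> \<open>The two sides differ by \<open>N * (y - x)\<close>.\<close>
      have "(x - N) * y < x * (y - N)" using N xy by (simp add: algebra_simps)
      then show "t < x / y" using N Ny by (simp add: t_def frac_less_eq divide_less_eq less_divide_eq ac_simps)
    qed (use False in simp)
    finally show ?thesis using N Nx Ny by (simp add: divide_less_eq ac_simps)
  qed
qed

text \<open>"Increasing" is read strictly: the constant function 1 is nondecreasing and meets the
  other hypotheses, but its roots are constant.\<close>

theorem theorem1p1:
  fixes N :: real and f :: "real \<Rightarrow> real"
  assumes "0 < N"
    and "\<And>x. N \<le> x \<Longrightarrow> 0 < f x"
    and "strict_mono_on {N..} f"
    and "log_convex_on {N..} f"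
    and "f N \<le> 1"
  shows "strict_mono_on {N<..} (\<lambda>x. f x powr (1 / x))"
proof -
  have "strict_mono_on {N<..} (\<lambda>x. ln (f x) / x)"
  proof (rule convex_increasing_divide_strict_mono)
    show "convex_on {N..} (\<lambda>x. ln (f x))" using assms(4) by (simp add: log_convex_on_def)
    show "strict_mono_on {N..} (\<lambda>x. ln (f x))" using assms(2,3) by (auto simp: strict_mono_on_def)
    show "ln (f N) \<le> 0" using assms(2,5) by simp
  qed (fact assms(1))
  \<comment> \<open>Positivity of \<open>f x\<close> rules out the default value
    \<open>0 powr a = 0\<close>.\<close>
  moreover have "f x powr (1 / x) = exp (ln (f x) / x)" if "N < x" for x
    using assms(2)[of x] that by (simp add: powr_def)
  ultimately show ?thesis by (simp add: strict_mono_on_def)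
qed

end
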